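(* Let $T$ be a semistandard tableau with $n$ boxes. The following are equivalent: ($C_n$) $T$ is unique of its shape and weight, i.e. $T$ is the only semistandard tableau having the same shape and the same weight as $T$. ($C'_n$) For any two columns of $T$, the later one (the one further to the right) is either obtained from the former by changing at most one value, or is a subset of the former.
   Context: Semistandard tableaux are of partition shape, weakly increasing along rows and strictly increasing down columns. The weight of a tableau records how many times each integer occurs as an entry. Each column is identified with the set of its entries; for two columns of equal length $k$, with entry sets $A$ and $B$, "$B$ is obtained from $A$ by changing at most one value" means $|A\cap B|\ge k-1$. *)

theory Defs
  imports Main
begin

text \<open>
  A tableau is the list of its rows, top to bottom (English notation), so row and column
  indices start at 0.
\<close>

type_synonym tableau = "int list list"

definition is_partition :: "nat list \<Rightarrow> bool" where
  "is_partition ks \<longleftrightarrow> sorted_wrt (\<ge>) ks \<and> (\<forall>k \<in> set ks. 0 < k)"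

definition shape :: "tableau \<Rightarrow> nat list" where
  "shape T = map length T"

definition boxes :: "tableau \<Rightarrow> nat" where
  "boxes T = sum_list (shape T)"

definition weight :: "tableau \<Rightarrow> int \<Rightarrow> nat" where
  "weight T x = count_list (concat T) x"

definition num_columns :: "tableau \<Rightarrow> nat" where
  "num_columns T = (case T of [] \<Rightarrow> 0 | r # _ \<Rightarrow> length r)"

definition column :: "tableau \<Rightarrow> nat \<Rightarrow> int list" where
  "column T j = map (\<lambda>r. r ! j) (filter (\<lambda>r. j < length r) T)"

definition semistandard :: "tableau \<Rightarrow> bool" where
  "semistandard T \<longleftrightarrow>
     is_partition (shape T) \<and>
     (\<forall>r \<in> set T. sorted r) \<and>
     (\<forall>j < num_columns T. sorted_wrt (<) (column T j))"

definition unique_of_shape_and_weight :: "tableau \<Rightarrow> bool" where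
  "unique_of_shape_and_weight T \<longleftrightarrow>
     (\<forall>T'. semistandard T' \<and> shape T' = shape T \<and> weight T' = weight T \<longrightarrow> T' = T)"

text \<open>
  The bound \<open>k - 1 \<le> card (A \<inter> B)\<close> is written without subtraction on \<^typ>\<open>nat\<close>.
\<close>

definition changes_at_most_one :: "int list \<Rightarrow> int list \<Rightarrow> bool" where
  "changes_at_most_one a b \<longleftrightarrow>
     length a = length b \<and> length a \<le> card (set a \<inter> set b) + 1"

definition column_condition :: "tableau \<Rightarrow> bool" where
  "column_condition T \<longleftrightarrow>
     (\<forall>i j. i < j \<and> j < num_columns T \<longrightarrow>
        changes_at_most_one (column T i) (column T j) \<or>
        set (column T j) \<subseteq> set (column T i))"

end

theory Submission
  imports Defs
begin

text \<open>
  Identify every column with its set of entries, and write \<open>A \<inter> {..m}\<close> for its entries up to a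
  threshold \<open>m\<close>. Strictly increasing columns form a semistandard tableau exactly if, for every
  \<open>m\<close>, the numbers \<open>card (A \<inter> {..m})\<close> weakly decrease from left to right; and these numbers
  determine the tableau.

  \<^bold>\<open>The column condition forces uniqueness.\<close> It says that columns of different lengths are nested,
  and that columns of equal length differ in at most one value. Let \<open>T'\<close> have the shape and weight of
  \<open>T\<close>. If a set \<open>X\<close> is comparable under inclusion with every column of \<open>T\<close>, then the columns of
  \<open>T\<close> have as many entries in \<open>X\<close> as their lengths permit; this total is fixed by the weight, so
  every column of \<open>T'\<close> also meets \<open>X\<close> in as many entries as possible
  (\<open>comparable_transfer\<close>). Take for \<open>X\<close> the intersection \<open>I\<close> and the union \<open>U\<close> of the columns of
  \<open>T\<close> of a given length \<open>k\<close>: the columns of \<open>T'\<close> of length \<open>k\<close> lie between \<open>I\<close> and \<open>U\<close> as well,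
  and on \<open>U - I\<close> the remaining columns of \<open>T\<close> and \<open>T'\<close> agree, containing all or nothing of it.
  A family of \<open>k\<close>-sets with pairwise intersections of size at least \<open>k - 1\<close> has a common core of
  size at least \<open>k - 1\<close> or a union of size at most \<open>k + 1\<close> (\<open>large_Int_imp_core_or_hull\<close>). In both
  cases any two \<open>k\<close>-sets between \<open>I\<close> and \<open>U\<close> differ in at most one value, so within the columns of
  length \<open>k\<close> of both tableaux the counts up to \<open>m\<close> take at most two adjacent values. A
  decreasing sequence of such values is determined by its sum, hence by the weight
  (\<open>antitone_close_le\<close>).

  \<^bold>\<open>A violation destroys uniqueness.\<close> Let columns \<open>A\<close> and \<open>B\<close>, in this order, violate the
  condition. Exchange some \<open>x \<in> A - B\<close> with some \<open>y \<in> B - A\<close> and sort all rows. Sorting the rows of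
  a filling with strict columns keeps the columns strict (\<open>semistandard_map_sort\<close>), so the result is
  semistandard of the same shape and weight. It differs from \<open>T\<close>: otherwise
  sorting the rows of the two new columns alone would give back \<open>A\<close> and \<open>B\<close>, and the count of
  \<open>A\<close> up to any \<open>m\<close> would be the larger one of the counts of the new columns; but \<open>x\<close>, \<open>y\<close> and
  \<open>m\<close> can be chosen such that it is not (\<open>exists_exchange\<close>).
\<close>

section \<open>Columns of a filling of partition shape\<close>

lemma column_Nil [simp]: "column [] j = []"
  by (simp add: column_def)

lemma column_Cons [simp]:
  "column (row # T) j = (if j < length row then row ! j # column T j else column T j)"
  by (simp add: column_def)

lemma length_column_shape: "length (column T j) = length (filter (\<lambda>k. j < k) (shape T))"
  by (induction T) (auto simp: shape_def)

lemma length_column_cong: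
  "shape T = shape T' \<Longrightarrow> length (column T j) = length (column T' j)"
  by (simp add: length_column_shape)

lemma length_shape_cong: "shape T = shape T' \<Longrightarrow> length T = length T'"
  by (metis length_map shape_def)

lemma length_row_cong:
  "shape T = shape T' \<Longrightarrow> r < length T \<Longrightarrow> length (T ! r) = length (T' ! r)"
  by (metis length_map nth_map shape_def)

lemma num_columns_cong: "shape T = shape T' \<Longrightarrow> num_columns T = num_columns T'"
  by (cases T; cases T') (auto simp: shape_def num_columns_def)

lemma is_partition_Cons:
  "is_partition (shape (row # T)) \<longleftrightarrow>
     is_partition (shape T) \<and> 0 < length row \<and> (\<forall>s \<in> set T. length s \<le> length row)"
  by (auto simp: is_partition_def shape_def)

lemma length_row_le_num_columns:
  "is_partition (shape T) \<Longrightarrow> row \<in> set T \<Longrightarrow> length row \<le> num_columns T"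
  by (cases T) (auto simp: is_partition_Cons num_columns_def)

lemma partition_rows_antimono:
  assumes "is_partition (shape T)" "r \<le> s" "s < length T"
  shows "length (T ! s) \<le> length (T ! r)"
proof (cases "r = s")
  case False
  then show ?thesis
    using assms sorted_wrt_nth_less[of "(\<ge>)" "shape T" r s]
    by (auto simp: is_partition_def shape_def)
qed simp

lemma less_length_column_iff:
  assumes "is_partition (shape T)"
  shows "r < length (column T j) \<longleftrightarrow> r < length T \<and> j < length (T ! r)"
  using assms
proof (induction T arbitrary: r)
  case (Cons row T)
  show ?case
  proof (cases "j < length row")
    case True
    with Cons show ?thesis by (cases r) (auto simp: is_partition_Cons)
  next
    case False
    then have short: "\<forall>s \<in> set (row # T). \<not> j < length s"
      using Cons.prems by (auto simp: is_partition_Cons dest!: bspec)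
    then have "column (row # T) j = []" by (simp add: column_def)
    with short show ?thesis by (metis list.size(3) not_less_zero nth_mem)
  qed
qed simp

lemma nth_column:
  assumes "is_partition (shape T)" "r < length (column T j)"
  shows "column T j ! r = T ! r ! j"
  using assms
proof (induction T arbitrary: r)
  case (Cons row T)
  show ?case
  proof (cases "j < length row")
    case True
    with Cons show ?thesis by (cases r) (auto simp: is_partition_Cons)
  next
    case False
    then have "column (row # T) j = []"
      using Cons.prems(1) by (auto simp: is_partition_Cons column_def filter_empty_conv)
    with Cons.prems show ?thesis by simp
  qed
qed simp

lemma eq_if_columns_eq:
  assumes "is_partition (shape T)" "shape T = shape T'" "\<And>j. column T j = column T' j"
  shows "T = T'"
proof (rule nth_equalityI)
  show "length T = length T'" using assms(2) by (rule length_shape_cong)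
next
  fix r assume r: "r < length T"
  show "T ! r = T' ! r"
  proof (rule nth_equalityI)
    show "length (T ! r) = length (T' ! r)" using assms(2) r by (rule length_row_cong)
  next
    fix j assume "j < length (T ! r)"
    with r have "r < length (column T j)" using assms(1) by (simp add: less_length_column_iff)
    then show "T ! r ! j = T' ! r ! j" using assms by (metis nth_column)
  qed
qed

lemma column_eq_Nil:
  assumes "is_partition (shape T)" "num_columns T \<le> j"
  shows "column T j = []"
  using assms length_row_le_num_columns[OF assms(1)]
  by (fastforce simp: column_def filter_empty_conv)

lemma columns_strict_iff:
  assumes "is_partition (shape T)"
  shows "(\<forall>j < num_columns T. sorted_wrt (<) (column T j)) \<longleftrightarrow>
    (\<forall>r j. Suc r < length T \<and> j < length (T ! Suc r) \<longrightarrow> T ! r ! j < T ! Suc r ! j)"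
proof -
  have "sorted_wrt (<) (column T j) \<longleftrightarrow>
      (\<forall>r. Suc r < length (column T j) \<longrightarrow> T ! r ! j < T ! Suc r ! j)" for j
    using assms by (simp add: sorted_wrt_iff_nth_Suc_transp nth_column)
  then have "sorted_wrt (<) (column T j) \<longleftrightarrow>
      (\<forall>r. Suc r < length T \<and> j < length (T ! Suc r) \<longrightarrow> T ! r ! j < T ! Suc r ! j)" for j
    using assms by (simp add: less_length_column_iff)
  moreover have "j < num_columns T" if "Suc r < length T" "j < length (T ! Suc r)" for r j
    using that length_row_le_num_columns[OF assms, of "T ! Suc r"] by auto
  ultimately show ?thesis by blast
qed

lemma strict_column:
  assumes "semistandard T"
  shows "sorted_wrt (<) (column T j)"
  using assms by (cases "j < num_columns T") (auto simp: semistandard_def column_eq_Nil)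

lemma distinct_column: "semistandard T \<Longrightarrow> distinct (column T j)"
  using strict_column strict_sorted_iff by blast

lemma weight_eq_sum_columns:
  assumes "\<forall>row \<in> set T. length row \<le> M"
  shows "weight T x = (\<Sum>j<M. count_list (column T j) x)"
  using assms
proof (induction T)
  case (Cons row T)
  have "count_list row x = card {j. j < length row \<and> row ! j = x}"
    by (simp add: count_list_eq_length_filter length_filter_conv_card eq_commute)
  also have "{j. j < length row \<and> row ! j = x} = {j \<in> {..<M}. j < length row \<and> row ! j = x}"
    using Cons.prems by auto
  also have "card \<dots> = (\<Sum>j<M. of_bool (j < length row \<and> row ! j = x))"
    by (simp add: of_bool_def sum.If_cases Int_def)
  finally have "count_list (row @ concat T) x =
      (\<Sum>j<M. of_bool (j < length row \<and> row ! j = x) + count_list (column T j) x)"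
    using Cons by (simp add: weight_def sum.distrib)
  also have "\<dots> = (\<Sum>j<M. count_list (column (row # T) j) x)"
    by (rule sum.cong) auto
  finally show ?case by (simp add: weight_def)
qed (simp add: weight_def)

lemma count_list_distinct: "distinct xs \<Longrightarrow> count_list xs x = of_bool (x \<in> set xs)"
  by (induction xs) auto

lemma weight_eq_card_columns:
  assumes "is_partition (shape T)" "\<And>j. distinct (column T j)"
  shows "weight T x = (\<Sum>j<num_columns T. of_bool (x \<in> set (column T j)))"
  using weight_eq_sum_columns[of T "num_columns T" x] length_row_le_num_columns[OF assms(1)]
  by (simp only: count_list_distinct[OF assms(2)]) blast

section \<open>Sorted lists and counting\<close>

lemma nth_le_iff_sorted:
  fixes xs :: "'a::linorder list"
  assumes "sorted xs" "k < length xs"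
  shows "xs ! k \<le> m \<longleftrightarrow> k < length (filter (\<lambda>x. x \<le> m) xs)"
  using assms
proof (induction xs arbitrary: k)
  case (Cons a xs)
  show ?case
  proof (cases "a \<le> m")
    case True
    with Cons show ?thesis by (cases k) auto
  next
    case False
    with Cons.prems have "\<forall>x \<in> set (a # xs). \<not> x \<le> m" by auto
    then have "filter (\<lambda>x. x \<le> m) (a # xs) = []" by (simp add: filter_empty_conv)
    with \<open>\<forall>x \<in> set (a # xs). \<not> x \<le> m\<close> Cons.prems(2) show ?thesis
      by (metis list.size(3) not_less_zero nth_mem)
  qed
qed simp

text \<open>
  The comparisons \<open>xs ! k \<le> m\<close> between entries of tableaux are turned into comparisons of
  cardinalities by this rule.
\<close>

lemma nth_le_iff_strict_sorted:
  fixes xs :: "'a::linorder list"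
  assumes "sorted_wrt (<) xs" "k < length xs"
  shows "xs ! k \<le> m \<longleftrightarrow> k < card (set xs \<inter> {..m})"
proof -
  have "sorted xs" "distinct xs" using assms(1) by (simp_all add: strict_sorted_iff)
  then have "length (filter (\<lambda>x. x \<le> m) xs) = card (set xs \<inter> {..m})"
    using distinct_card[of "filter (\<lambda>x. x \<le> m) xs"] by (simp add: Int_def)
  then show ?thesis using nth_le_iff_sorted[OF \<open>sorted xs\<close> assms(2)] by simp
qed

text \<open>
  The \<open>k + 1\<close> smallest entries of \<open>ys\<close> are at most \<open>sort ys ! k\<close>, and at the same positions \<open>xs\<close> has
  smaller entries; so \<open>xs\<close> has \<open>k + 1\<close> entries below \<open>sort ys ! k\<close>.
\<close>

lemma sort_nth_less:
  fixes xs ys :: "int list"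
  assumes len: "length ys \<le> length xs"
    and less: "\<And>i. i < length ys \<Longrightarrow> xs ! i < ys ! i"
    and k: "k < length ys"
  shows "sort xs ! k < sort ys ! k"
proof -
  define v where "v = sort ys ! k"
  have fl: "length (filter P (sort zs)) = card {i. i < length zs \<and> P (zs ! i)}"
    for P and zs :: "int list"
    by (metis filter_sort length_filter_conv_card length_sort)
  have "k < length (filter (\<lambda>x. x \<le> v) (sort ys))"
    using nth_le_iff_sorted[of "sort ys" k v] k by (simp add: v_def)
  also have "\<dots> = card {i. i < length ys \<and> ys ! i \<le> v}" by (rule fl)
  also have "\<dots> \<le> card {i. i < length xs \<and> xs ! i \<le> v - 1}"
    using len less by (intro card_mono) (force+)
  also have "\<dots> = length (filter (\<lambda>x. x \<le> v - 1) (sort xs))" by (rule fl[symmetric])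
  finally have "sort xs ! k \<le> v - 1"
    using nth_le_iff_sorted[of "sort xs" k "v - 1"] k len by simp
  then show ?thesis by (simp add: v_def)
qed

text \<open>
  The last entry up to \<open>m\<close> in column \<open>j\<close> has an entry of column \<open>i\<close> to its left in the same row,
  which is again at most \<open>m\<close>.
\<close>

lemma column_counts_antimono:
  assumes "semistandard T" "i \<le> j"
  shows "card (set (column T j) \<inter> {..m}) \<le> card (set (column T i) \<inter> {..m})"
proof (cases "card (set (column T j) \<inter> {..m})")
  case (Suc r)
  have part: "is_partition (shape T)" using assms by (simp add: semistandard_def)
  have "Suc r \<le> card (set (column T j))" using Suc by (metis Int_lower1 List.finite_set card_mono)
  then have rj: "r < length (column T j)" using card_length[of "column T j"] by linarith
  then have r: "r < length T" "j < length (T ! r)" using part by (simp_all add: less_length_column_iff)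
  then have ri: "r < length (column T i)" using part assms(2) by (simp add: less_length_column_iff)
  have "sorted (T ! r)" using assms r by (simp add: semistandard_def)
  then have "T ! r ! i \<le> T ! r ! j" using assms(2) r by (intro sorted_nth_mono)
  also have "T ! r ! j \<le> m"
    using nth_le_iff_strict_sorted[OF strict_column[OF assms(1)] rj, of m] Suc
    by (simp add: nth_column[OF part rj])
  finally show ?thesis
    using nth_le_iff_strict_sorted[OF strict_column[OF assms(1)] ri, of m] Suc
    by (simp add: nth_column[OF part ri])
qed simp

section \<open>Set families determined by sizes and degrees\<close>

lemma sum_card_Int_eq_sum_degrees:
  assumes "finite J" "finite X"
  shows "(\<Sum>j\<in>J. card (F j \<inter> X)) = (\<Sum>x\<in>X. \<Sum>j\<in>J. of_bool (x \<in> F j))"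
proof -
  have "card (F j \<inter> X) = (\<Sum>x\<in>X. of_bool (x \<in> F j))" for j
    using assms(2) by (simp add: Int_commute)
  then have "(\<Sum>j\<in>J. card (F j \<inter> X)) = (\<Sum>j\<in>J. \<Sum>x\<in>X. of_bool (x \<in> F j))"
    by (simp only:)
  also have "\<dots> = (\<Sum>x\<in>X. \<Sum>j\<in>J. of_bool (x \<in> F j))" by (rule sum.swap)
  finally show ?thesis .
qed

text \<open>
  Count incidences with \<open>X\<close>. A set of size \<open>card (F j)\<close> meets \<open>X\<close> in at most
  \<open>min (card (F j)) (card X)\<close> elements, and \<open>F j\<close> attains this bound since it is comparable with
  \<open>X\<close>. The degrees fix the sum over \<open>j\<close> of these intersection sizes, so each \<open>G j\<close> attains the
  bound too.
\<close>

lemma comparable_transfer: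
  fixes F G :: "'i \<Rightarrow> 'a set"
  assumes "finite J" "finite X"
    and fin: "\<And>j. j \<in> J \<Longrightarrow> finite (F j)" "\<And>j. j \<in> J \<Longrightarrow> finite (G j)"
    and size: "\<And>j. j \<in> J \<Longrightarrow> card (F j) = card (G j)"
    and deg: "\<And>x. (\<Sum>j\<in>J. of_bool (x \<in> F j)) = (\<Sum>j\<in>J. of_bool (x \<in> G j) :: nat)"
    and comp: "\<And>j. j \<in> J \<Longrightarrow> F j \<subseteq> X \<or> X \<subseteq> F j"
    and j: "j \<in> J"
  shows "(F j \<subseteq> X \<longrightarrow> G j \<subseteq> X) \<and> (X \<subseteq> F j \<longrightarrow> X \<subseteq> G j)"
proof -
  have le: "card (G i \<inter> X) \<le> card (F i \<inter> X)" if i: "i \<in> J" for i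
    using comp[OF i]
  proof
    assume "F i \<subseteq> X"
    then have "card (F i \<inter> X) = card (G i)" using size[OF i] by (simp add: Int_absorb2)
    then show ?thesis using fin(2)[OF i] by (simp add: card_mono)
  next
    assume "X \<subseteq> F i"
    then show ?thesis using assms(2) by (simp add: Int_absorb1 card_mono)
  qed
  have "(\<Sum>j\<in>J. card (G j \<inter> X)) = (\<Sum>j\<in>J. card (F j \<inter> X))"
    by (simp only: sum_card_Int_eq_sum_degrees[OF assms(1,2)] deg)
  then have eq: "card (G j \<inter> X) = card (F j \<inter> X)"
    using sum_mono_inv[of "\<lambda>j. card (G j \<inter> X)" J "\<lambda>j. card (F j \<inter> X)" j] le j assms(1) by blast
  show ?thesis
  proof (intro conjI impI)
    assume "F j \<subseteq> X"
    then have "card (G j \<inter> X) = card (G j)" using eq size[OF j] by (simp add: Int_absorb2)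
    then show "G j \<subseteq> X" using fin(2)[OF j] card_subset_eq[of "G j" "G j \<inter> X"] by auto
  next
    assume "X \<subseteq> F j"
    then have "card (G j \<inter> X) = card X" using eq by (simp add: Int_absorb1)
    then show "X \<subseteq> G j" using assms(2) card_subset_eq[of X "G j \<inter> X"] by auto
  qed
qed

text \<open>
  For two distinct members \<open>A\<close> and \<open>B\<close>, the set \<open>A \<inter> B\<close> serves as \<open>C\<close> or \<open>A \<union> B\<close> as \<open>D\<close>: every
  member contains \<open>A \<inter> B\<close> or is contained in \<open>A \<union> B\<close>, and if one member does not contain
  \<open>A \<inter> B\<close>, then no member leaves \<open>A \<union> B\<close>.
\<close>

lemma large_Int_imp_core_or_hull:
  fixes \<F> :: "'a set set"
  assumes fin: "\<And>A. A \<in> \<F> \<Longrightarrow> finite A"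
    and size: "\<And>A. A \<in> \<F> \<Longrightarrow> card A = k"
    and pair: "\<And>A B. A \<in> \<F> \<Longrightarrow> B \<in> \<F> \<Longrightarrow> k \<le> card (A \<inter> B) + 1"
    and ne: "\<F> \<noteq> {}"
  shows "(\<exists>C. C \<subseteq> \<Inter>\<F> \<and> finite C \<and> k \<le> card C + 1) \<or>
    (\<exists>D. \<Union>\<F> \<subseteq> D \<and> finite D \<and> card D \<le> k + 1)"
proof (rule disjCI)
  assume no_hull: "\<not> (\<exists>D. \<Union>\<F> \<subseteq> D \<and> finite D \<and> card D \<le> k + 1)"
  obtain A where A: "A \<in> \<F>" using ne by blast
  then obtain B where B: "B \<in> \<F>" "B \<noteq> A"
    using no_hull fin[OF A] size[OF A] by (metis Sup_least le_add1 order_refl)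
  let ?C = "A \<inter> B" and ?D = "A \<union> B"
  have finAB: "finite A" "finite B" using A B fin by auto
  have C: "k \<le> card ?C + 1" using pair A B by blast
  have "card ?D + card ?C = 2 * k" using card_Un_Int[OF finAB] size A B by simp
  then have D: "card ?D \<le> k + 1" using C by linarith
  have "?C \<subset> A" using A B size finAB by (metis Int_lower1 Int_lower2 card_subset_eq psubsetI)
  then have "card ?C < k" using finAB size[OF A] psubset_card_mono by metis
  with C have cardC: "card ?C + 1 = k" by simp
  have small: "card (?C \<inter> E) + 2 \<le> k" if "\<not> ?C \<subseteq> E" for E
  proof -
    have "?C \<inter> E \<subset> ?C" using that by blast
    then show ?thesis using finAB cardC psubset_card_mono[of ?C "?C \<inter> E"] by simp
  qed
  \<comment> \<open>A member that omits an element \<open>c\<close> of the core has to be \<open>(A \<union> B) - {c}\<close>.\<close>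
  have in_hull: "E \<subseteq> ?D" if E: "E \<in> \<F>" and nC: "\<not> ?C \<subseteq> E" for E
  proof -
    have "card (E \<inter> A) + card (E \<inter> B) = card (E \<inter> ?D) + card (?C \<inter> E)"
      using card_Un_Int[of "E \<inter> A" "E \<inter> B"] finAB by (simp add: Int_Un_distrib Int_ac)
    then have "card E \<le> card (E \<inter> ?D)"
      using pair[OF E A] pair[OF E B(1)] small[OF nC] size[OF E] by linarith
    then show ?thesis using fin[OF E] by (metis Int_lower1 card_seteq inf.absorb_iff1)
  qed
  have "?C \<subseteq> E" if E: "E \<in> \<F>" for E
  proof (rule ccontr)
    assume nC: "\<not> ?C \<subseteq> E"
    have "X \<subseteq> ?D" if X: "X \<in> \<F>" for X
    proof (rule ccontr)
      assume "\<not> X \<subseteq> ?D"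
      then obtain e where e: "e \<in> X" "e \<notin> ?D" by blast
      \<comment> \<open>\<open>X\<close> is the core with \<open>e\<close> added, which has too little in common with \<open>E\<close>.\<close>
      have "?C \<subseteq> X" using in_hull[OF X] \<open>\<not> X \<subseteq> ?D\<close> by blast
      then have "insert e ?C \<subseteq> X" using e by blast
      moreover have "card (insert e ?C) = card X" using e finAB cardC size[OF X] by simp
      ultimately have "insert e ?C = X" using fin[OF X] by (metis card_subset_eq)
      then have "X \<inter> E \<subseteq> ?C \<inter> E" using in_hull[OF E nC] e by blast
      then have "card (X \<inter> E) \<le> card (?C \<inter> E)" using finAB by (intro card_mono) auto
      then show False using pair[OF X E] small[OF nC] by linarith
    qed
    then have "\<Union>\<F> \<subseteq> ?D" by blast
    with no_hull D finAB show False by blast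
  qed
  then show "\<exists>C. C \<subseteq> \<Inter>\<F> \<and> finite C \<and> k \<le> card C + 1"
    using C finAB by (meson Inter_greatest finite_Int)
qed

lemma card_Diff_le_one:
  assumes "finite X" "card X = k" "k \<le> card (X \<inter> Y) + 1"
  shows "card (X - Y) \<le> 1"
proof -
  have "card (X - Y) + card (X \<inter> Y) = k"
    using assms by (metis Diff_Int card_Int_Diff add.commute)
  then show ?thesis using assms(3) by linarith
qed

text \<open>
  The core \<open>C\<close> lies in \<open>X \<inter> Y\<close>, or the hull \<open>D\<close> contains \<open>X \<union> Y\<close>; both make \<open>X - Y\<close> at most a
  singleton.
\<close>

lemma interval_members_close:
  fixes X Y :: "'a set"
  assumes core_or_hull: "(\<exists>C. C \<subseteq> I \<and> finite C \<and> k \<le> card C + 1) \<or>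
      (\<exists>D. U \<subseteq> D \<and> finite D \<and> card D \<le> k + 1)"
    and X: "finite X" "card X = k" "I \<subseteq> X" "X \<subseteq> U"
    and Y: "finite Y" "card Y = k" "I \<subseteq> Y" "Y \<subseteq> U"
  shows "card (X \<inter> Z) \<le> card (Y \<inter> Z) + 1"
proof -
  have "k \<le> card (X \<inter> Y) + 1"
    using core_or_hull
  proof
    assume "\<exists>C. C \<subseteq> I \<and> finite C \<and> k \<le> card C + 1"
    then obtain C where C: "C \<subseteq> I" "k \<le> card C + 1" by blast
    have "card C \<le> card (X \<inter> Y)" using C X Y by (intro card_mono) auto
    with C show ?thesis by linarith
  next
    assume "\<exists>D. U \<subseteq> D \<and> finite D \<and> card D \<le> k + 1"
    then obtain D where D: "U \<subseteq> D" "finite D" "card D \<le> k + 1" by blast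
    have "card (X \<union> Y) \<le> card D" using D X Y by (intro card_mono) auto
    moreover have "card (X \<union> Y) + card (X \<inter> Y) = 2 * k" using card_Un_Int[of X Y] X Y by simp
    ultimately show ?thesis using D by linarith
  qed
  then have one: "card (X - Y) \<le> 1" by (rule card_Diff_le_one[OF X(1,2)])
  have "card (X \<inter> Z) \<le> card ((Y \<inter> Z) \<union> (X - Y))" using X(1) Y(1) by (intro card_mono) auto
  also have "\<dots> \<le> card (Y \<inter> Z) + card (X - Y)" by (rule card_Un_le)
  finally show ?thesis using one by linarith
qed

text \<open>
  Suppose \<open>f c < g c\<close>. Then \<open>f j \<le> f c + 1 \<le> g c \<le> g j\<close> for \<open>j\<close> up to \<open>c\<close>, and
  \<open>f j \<le> f c \<le> g c - 1 \<le> g j\<close> beyond, so the sum of \<open>f\<close> is the smaller one. Exchanging \<open>f\<close> and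
  \<open>g\<close> gives \<open>f = g\<close> on \<open>J\<close>.
\<close>

lemma antitone_close_le:
  fixes f g :: "nat \<Rightarrow> nat"
  assumes "finite J" "sum f J = sum g J"
    and anti: "\<And>i j. i \<in> J \<Longrightarrow> j \<in> J \<Longrightarrow> i \<le> j \<Longrightarrow> f j \<le> f i"
      "\<And>i j. i \<in> J \<Longrightarrow> j \<in> J \<Longrightarrow> i \<le> j \<Longrightarrow> g j \<le> g i"
    and close: "\<And>i j. i \<in> J \<Longrightarrow> j \<in> J \<Longrightarrow> f i \<le> f j + 1"
      "\<And>i j. i \<in> J \<Longrightarrow> j \<in> J \<Longrightarrow> g i \<le> g j + 1"
    and c: "c \<in> J"
  shows "g c \<le> f c"
proof (rule ccontr)
  assume "\<not> g c \<le> f c"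
  then have less: "f c < g c" by simp
  have "f j \<le> g j" if j: "j \<in> J" for j
  proof (cases "j \<le> c")
    case True
    then have "g c \<le> g j" using anti(2) j c by blast
    then show ?thesis using close(1)[OF j c] less by linarith
  next
    case False
    then have "f j \<le> f c" using anti(1) j c by simp
    then show ?thesis using close(2)[OF c j] less by linarith
  qed
  then have "sum f J < sum g J" using less c assms(1) by (intro sum_strict_mono_ex1) auto
  with assms(2) show False by simp
qed

lemma eq_if_initial_counts_eq:
  fixes A B :: "int set"
  assumes "finite A" "finite B" and eq: "\<And>m. card (A \<inter> {..m}) = card (B \<inter> {..m})"
  shows "A = B"
proof -
  have mem: "x \<in> A \<longleftrightarrow> card (A \<inter> {..x}) \<noteq> card (A \<inter> {..x - 1})" if "finite A" for x and A :: "int set"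
  proof (cases "x \<in> A")
    case True
    then have "A \<inter> {..x} = insert x (A \<inter> {..x - 1})" by auto
    then show ?thesis using that True by simp
  next
    case False
    then have "z \<le> x \<longleftrightarrow> z \<le> x - 1" if "z \<in> A" for z
      using that by (cases "z = x") auto
    then have "A \<inter> {..x} = A \<inter> {..x - 1}" by auto
    then show ?thesis using False by simp
  qed
  show ?thesis by (rule set_eqI) (simp only: mem[OF assms(1)] mem[OF assms(2)] eq)
qed

text \<open>
  Here \<open>F\<close> and \<open>G\<close> are the columns of two tableaux of the same shape and weight, the first of which
  satisfies the column condition. The members of one size \<open>k\<close> are treated together: the incidences
  with \<open>U - I\<close> that come from the other members are the same in both families, and what remains is
  rigid because of the order.
\<close>

lemma ordered_family_unique:
  fixes F G :: "nat \<Rightarrow> int set"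
  assumes fin: "\<And>j. finite (F j)" "\<And>j. finite (G j)"
    and size: "\<And>j. card (F j) = card (G j)"
    and deg: "\<And>x. (\<Sum>j<M. of_bool (x \<in> F j)) = (\<Sum>j<M. of_bool (x \<in> G j) :: nat)"
    and anti: "\<And>i j m. i \<le> j \<Longrightarrow> card (F j \<inter> {..m}) \<le> card (F i \<inter> {..m})"
      "\<And>i j m. i \<le> j \<Longrightarrow> card (G j \<inter> {..m}) \<le> card (G i \<inter> {..m})"
    and nested: "\<And>i j. i < M \<Longrightarrow> j < M \<Longrightarrow> card (F j) < card (F i) \<Longrightarrow> F j \<subseteq> F i"
    and close: "\<And>i j. i < M \<Longrightarrow> j < M \<Longrightarrow> card (F i) = card (F j) \<Longrightarrow>
      card (F i) \<le> card (F i \<inter> F j) + 1"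
    and c: "c < M"
  shows "F c = G c"
proof -
  define k where "k = card (F c)"
  define J where "J = {j. j < M \<and> card (F j) = k}"
  define I where "I = \<Inter>(F ` J)"
  define U where "U = \<Union>(F ` J)"
  have cJ: "c \<in> J" using c by (simp add: J_def k_def)
  have JM: "J \<subseteq> {..<M}" by (auto simp: J_def)
  then have finJ: "finite J" using finite_subset by blast
  have finI: "finite I" using cJ fin by (auto simp: I_def)
  have finU: "finite U" using finJ fin by (auto simp: U_def)
  have long: "U \<subseteq> F j" if "j < M" "k < card (F j)" for j
    using that nested by (fastforce simp: U_def J_def)
  have short: "F j \<subseteq> I" if "j < M" "card (F j) < k" for j
    using that nested by (fastforce simp: I_def J_def)
  have group: "I \<subseteq> F j" "F j \<subseteq> U" if "j \<in> J" for j
    using that by (auto simp: I_def U_def)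
  have IU: "I \<subseteq> U" using group[OF cJ] by blast
  have cases: "j \<in> J \<or> k < card (F j) \<or> card (F j) < k" if "j < M" for j
    using that by (auto simp: J_def)
  have transfer: "(F j \<subseteq> X \<longrightarrow> G j \<subseteq> X) \<and> (X \<subseteq> F j \<longrightarrow> X \<subseteq> G j)"
    if "X = I \<or> X = U" "j < M" for X j
  proof (rule comparable_transfer[of "{..<M}" X F G j])
    show "F i \<subseteq> X \<or> X \<subseteq> F i" if "i \<in> {..<M}" for i
      using cases[of i] long[of i] short[of i] group[of i] that \<open>X = I \<or> X = U\<close> IU by blast
  qed (use that(1,2) finI finU in \<open>auto intro: fin size deg simp del: sum_of_bool_eq\<close>)
  have groupG: "I \<subseteq> G j" "G j \<subseteq> U" if "j \<in> J" for j
    using transfer[of I j] transfer[of U j] group[OF that] that JM by auto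
  have outside: "F j \<inter> (U - I) = G j \<inter> (U - I)" if "j < M" "j \<notin> J" for j
    using cases[OF that(1)] that(2) transfer[of I j] transfer[of U j] that(1) long[of j] short[of j]
    by blast
  have core_or_hull: "(\<exists>C. C \<subseteq> I \<and> finite C \<and> k \<le> card C + 1) \<or>
      (\<exists>D. U \<subseteq> D \<and> finite D \<and> card D \<le> k + 1)"
    unfolding I_def U_def
  proof (rule large_Int_imp_core_or_hull)
    fix A B assume "A \<in> F ` J" "B \<in> F ` J"
    then obtain i j where "A = F i" "B = F j" "i < M" "j < M" "card (F i) = k" "card (F j) = k"
      by (auto simp: J_def)
    then show "k \<le> card (A \<inter> B) + 1" using close[of i j] by simp
  qed (use fin cJ in \<open>auto simp: J_def\<close>)
  have sizeJ: "card (F j) = k" "card (G j) = k" if "j \<in> J" for j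
    using that size[of j] by (simp_all add: J_def)
  have near: "card (F i \<inter> Z) \<le> card (F j \<inter> Z) + 1" "card (G i \<inter> Z) \<le> card (G j \<inter> Z) + 1"
    if "i \<in> J" "j \<in> J" for i j Z
    by (intro interval_members_close[OF core_or_hull] fin sizeJ group groupG that)+
  have counts: "card (F c \<inter> {..m}) = card (G c \<inter> {..m})" for m
  proof -
    let ?f = "\<lambda>j. card (F j \<inter> {..m})" and ?g = "\<lambda>j. card (G j \<inter> {..m})"
    let ?Z = "(U - I) \<inter> {..m}"
    have split: "card (A \<inter> {..m}) = card (I \<inter> {..m}) + card (A \<inter> ?Z)"
      if "I \<subseteq> A" "A \<subseteq> U" for A
    proof -
      have "A \<inter> {..m} = (I \<inter> {..m}) \<union> (A \<inter> ?Z)" using that by blast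
      then show ?thesis using finI finU by (simp add: card_Un_disjoint disjoint_iff)
    qed
    have "finite ?Z" using finU by simp
    then have "(\<Sum>j<M. card (F j \<inter> ?Z)) = (\<Sum>j<M. card (G j \<inter> ?Z))"
      by (simp only: sum_card_Int_eq_sum_degrees[OF finite_lessThan] deg)
    moreover have "(\<Sum>j\<in>{..<M} - J. card (F j \<inter> ?Z)) = (\<Sum>j\<in>{..<M} - J. card (G j \<inter> ?Z))"
      using outside by (intro sum.cong) (auto simp: Int_assoc[symmetric])
    ultimately have "(\<Sum>j\<in>J. card (F j \<inter> ?Z)) = (\<Sum>j\<in>J. card (G j \<inter> ?Z))"
      using sum.subset_diff[OF JM finite_lessThan, of "\<lambda>j. card (F j \<inter> ?Z)"]
        sum.subset_diff[OF JM finite_lessThan, of "\<lambda>j. card (G j \<inter> ?Z)"] by linarith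
    moreover have "sum ?f J = (\<Sum>j\<in>J. card (I \<inter> {..m}) + card (F j \<inter> ?Z))"
      by (intro sum.cong refl split group)
    moreover have "sum ?g J = (\<Sum>j\<in>J. card (I \<inter> {..m}) + card (G j \<inter> ?Z))"
      by (intro sum.cong refl split groupG)
    ultimately have sums: "sum ?f J = sum ?g J" by (simp only: sum.distrib)
    have "?g c \<le> ?f c"
      by (rule antitone_close_le[OF finJ sums _ _ _ _ cJ]) (rule anti near; assumption)+
    moreover have "?f c \<le> ?g c"
      by (rule antitone_close_le[OF finJ sums[symmetric] _ _ _ _ cJ]) (rule anti near; assumption)+
    ultimately show ?thesis by simp
  qed
  then show ?thesis using fin by (intro eq_if_initial_counts_eq)
qed

section \<open>The column condition forces uniqueness\<close>

lemma card_set_column: "semistandard T \<Longrightarrow> card (set (column T j)) = length (column T j)"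
  by (rule distinct_card[OF distinct_column])

lemma card_column_antimono:
  assumes "semistandard T" "i \<le> j"
  shows "card (set (column T j)) \<le> card (set (column T i))"
proof -
  have "is_partition (shape T)" using assms by (simp add: semistandard_def)
  then have "\<not> length (column T i) < length (column T j)"
    using assms(2) less_length_column_iff[of T "length (column T i)" j]
      less_length_column_iff[of T "length (column T i)" i] by auto
  then show ?thesis by (simp add: card_set_column[OF assms(1)])
qed

text \<open>
  Since columns get shorter to the right, the column condition is symmetric in the two columns: the
  smaller is contained in the larger, or both have the same size and differ in at most one value.
\<close>

lemma column_condition_imp_unique:
  assumes T: "semistandard T" and cond: "column_condition T"
  shows "unique_of_shape_and_weight T"
  unfolding unique_of_shape_and_weight_def
proof (intro allI impI)
  fix T' assume "semistandard T' \<and> shape T' = shape T \<and> weight T' = weight T"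
  then have T': "semistandard T'" and sh: "shape T' = shape T" and wt: "weight T' = weight T" by auto
  have part: "is_partition (shape T)" and part': "is_partition (shape T')"
    using T T' by (simp_all add: semistandard_def)
  define M where "M = num_columns T"
  define F where "F = (\<lambda>j. set (column T j))"
  define G where "G = (\<lambda>j. set (column T' j))"
  have pair: "card (F j) < card (F i) \<and> F j \<subseteq> F i \<or>
      card (F i) = card (F j) \<and> card (F i) \<le> card (F i \<inter> F j) + 1" if "i \<le> j" "j < M" for i j
  proof (cases "i = j")
    case False
    have le: "card (F j) \<le> card (F i)" using T that by (simp add: F_def card_column_antimono)
    have "changes_at_most_one (column T i) (column T j) \<or> F j \<subseteq> F i"
      using cond that False by (simp add: column_condition_def M_def F_def)
    then show ?thesis
    proof
      assume "F j \<subseteq> F i"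
      then show ?thesis using le by (cases "card (F j) = card (F i)") (simp_all add: Int_absorb1)
    qed (simp add: changes_at_most_one_def F_def card_set_column[OF T])
  qed simp
  have eq: "F j = G j" if "j < M" for j
  proof (rule ordered_family_unique[of F G M])
    show "card (F j) = card (G j)" for j
      using length_column_cong[OF sh, of j]
      by (simp add: F_def G_def card_set_column[OF T] card_set_column[OF T'])
    show "(\<Sum>j<M. of_bool (x \<in> F j)) = (\<Sum>j<M. of_bool (x \<in> G j) :: nat)" for x
    proof -
      have "weight T x = (\<Sum>j<M. of_bool (x \<in> F j))"
        unfolding F_def M_def by (rule weight_eq_card_columns[OF part distinct_column[OF T]])
      moreover have "weight T' x = (\<Sum>j<M. of_bool (x \<in> G j))"
        unfolding G_def M_def num_columns_cong[OF sh, symmetric]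
        by (rule weight_eq_card_columns[OF part' distinct_column[OF T']])
      ultimately show ?thesis by (simp only: wt)
    qed
    show "F j \<subseteq> F i" if "i < M" "j < M" "card (F j) < card (F i)" for i j
    proof (cases "i \<le> j")
      case True
      from pair[OF True that(2)] that(3) show ?thesis by (elim disjE conjE) simp_all
    next
      case False
      then have "j \<le> i" by simp
      from pair[OF this that(1)] that(3) show ?thesis by (elim disjE conjE) simp_all
    qed
    show "card (F i) \<le> card (F i \<inter> F j) + 1" if "i < M" "j < M" "card (F i) = card (F j)" for i j
    proof (cases "i \<le> j")
      case True
      from pair[OF True that(2)] that(3) show ?thesis by (elim disjE conjE) simp_all
    next
      case False
      then have "j \<le> i" by simp
      from pair[OF this that(1)] that(3) show ?thesis
        by (elim disjE conjE) (simp_all add: Int_commute)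
    qed
    show "card (F j \<inter> {..m}) \<le> card (F i \<inter> {..m})" if "i \<le> j" for i j m
      using column_counts_antimono[OF T that] by (simp add: F_def)
    show "card (G j \<inter> {..m}) \<le> card (G i \<inter> {..m})" if "i \<le> j" for i j m
      using column_counts_antimono[OF T' that] by (simp add: G_def)
  qed (simp_all add: F_def G_def that)
  have "column T' j = column T j" for j
  proof (cases "j < M")
    case True
    then show ?thesis
      using eq[OF True] strict_column[OF T] strict_column[OF T']
      by (metis F_def G_def strict_sorted_equal)
  next
    case False
    then show ?thesis
      using column_eq_Nil[of T j] column_eq_Nil[of T' j] num_columns_cong[OF sh] part sh
      by (simp add: M_def)
  qed
  then show "T' = T" using eq_if_columns_eq[of T' T] part sh by simp
qed

section \<open>Exchanging entries between two columns\<close>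

text \<open>
  The assumptions give \<open>card (A - B) \<ge> 2\<close> and \<open>B - A \<noteq> {}\<close>. If some \<open>y \<in> B - A\<close> lies below some
  \<open>x \<in> A - B\<close>, the exchange raises the count of \<open>A\<close> at \<open>m = y\<close>. Otherwise all of \<open>A - B\<close> lies
  below \<open>B - A\<close>; then exchange the largest element \<open>x\<close> of \<open>A - B\<close> with any \<open>y\<close>, and take \<open>m = x\<close>: up to
  \<open>m\<close>, \<open>A\<close> loses one element, and \<open>B\<close>, which was behind by at least two, gains only one.
\<close>

lemma exists_exchange:
  fixes A B :: "int set"
  assumes fin: "finite A" "finite B" and le: "card B \<le> card A" and nsub: "\<not> B \<subseteq> A"
    and far: "card A = card B \<Longrightarrow> card (A \<inter> B) + 1 < card A"
  obtains x y m where "x \<in> A - B" "y \<in> B - A"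
    "card (insert y (A - {x}) \<inter> {..m}) > card (A \<inter> {..m}) \<or>
     card (insert y (A - {x}) \<inter> {..m}) < card (A \<inter> {..m}) \<and>
     card (insert x (B - {y}) \<inter> {..m}) < card (A \<inter> {..m})"
proof -
  have cA: "card A = card (A - B) + card (A \<inter> B)" using fin by (metis card_Int_Diff add.commute)
  have cB: "card B = card (B - A) + card (A \<inter> B)"
    using fin by (metis card_Int_Diff add.commute Int_commute)
  have neB: "B - A \<noteq> {}" using nsub by blast
  have b: "1 \<le> card (B - A)" using neB fin by (simp add: Suc_le_eq card_gt_0_iff)
  then have a: "2 \<le> card (A - B)" using cA cB le far by linarith
  then have neA: "A - B \<noteq> {}" by force
  show ?thesis
  proof (cases "\<exists>x \<in> A - B. \<exists>y \<in> B - A. y < x")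
    case True
    then obtain x y where xy: "x \<in> A - B" "y \<in> B - A" "y < x" by blast
    have "insert y (A - {x}) \<inter> {..y} = insert y (A \<inter> {..y})" using xy by auto
    then have "card (insert y (A - {x}) \<inter> {..y}) > card (A \<inter> {..y})" using xy fin by simp
    then show ?thesis using that xy by blast
  next
    case False
    define x where "x = Max (A - B)"
    have x: "x \<in> A - B" using neA fin by (simp add: x_def Max_in del: Diff_iff)
    have maxx: "z \<le> x" if "z \<in> A - B" for z using that fin by (simp add: x_def)
    obtain y where y: "y \<in> B - A" using neB by blast
    have above: "x < z" if "z \<in> B - A" for z using False x that by (metis DiffD1 DiffD2 linorder_less_linear)
    have "A \<inter> {..x} = (A - B) \<union> (A \<inter> B \<inter> {..x})" using maxx by auto
    moreover have "card ((A - B) \<union> (A \<inter> B \<inter> {..x})) = card (A - B) + card (A \<inter> B \<inter> {..x})"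
      using fin by (intro card_Un_disjoint) auto
    ultimately have cAx: "card (A \<inter> {..x}) \<ge> card (A \<inter> B \<inter> {..x}) + 2" using a by simp
    have "insert y (A - {x}) \<inter> {..x} = (A \<inter> {..x}) - {x}" using above[OF y] by auto
    then have "card (insert y (A - {x}) \<inter> {..x}) < card (A \<inter> {..x})"
      using x fin by (simp add: card_Diff_singleton) (use cAx in linarith)
    moreover have "insert x (B - {y}) \<inter> {..x} = insert x (A \<inter> B \<inter> {..x})"
      using above y x by force
    then have "card (insert x (B - {y}) \<inter> {..x}) < card (A \<inter> {..x})"
      using x fin cAx by simp
    ultimately show ?thesis using that[OF x y] by blast
  qed
qed

section \<open>Sorting the rows of a filling with strict columns\<close>

definition tableau_of_columns :: "nat list \<Rightarrow> (nat \<Rightarrow> int list) \<Rightarrow> tableau" where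
  "tableau_of_columns ks cs = map (\<lambda>r. map (\<lambda>c. cs c ! r) [0..<ks ! r]) [0..<length ks]"

lemma shape_tableau_of_columns [simp]: "shape (tableau_of_columns ks cs) = ks"
  by (simp add: shape_def tableau_of_columns_def comp_def map_nth)

lemma column_tableau_of_columns:
  assumes "is_partition (shape T)" "length (cs j) = length (column T j)"
  shows "column (tableau_of_columns (shape T) cs) j = cs j"
proof (rule nth_equalityI)
  let ?W = "tableau_of_columns (shape T) cs"
  show len: "length (column ?W j) = length (cs j)"
    using assms(2) length_column_cong[of ?W T j] by simp
  fix r assume r: "r < length (column ?W j)"
  have part: "is_partition (shape ?W)" using assms(1) by simp
  have "r < length ?W \<and> j < length (?W ! r)" using r less_length_column_iff[OF part] by blast
  then have "?W ! r ! j = cs j ! r" by (auto simp: tableau_of_columns_def)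
  then show "column ?W j ! r = cs j ! r" using nth_column[OF part r] by simp
qed

lemma shape_map_sort [simp]: "shape (map sort W) = shape W"
  by (simp add: shape_def comp_def)

lemma weight_map_sort [simp]: "weight (map sort W) = weight W"
proof -
  have "count_list (sort xs) x = count_list xs x" for xs :: "int list" and x
    by (metis count_list_eq_length_filter filter_sort length_sort)
  then have "count_list (concat (map sort W)) x = count_list (concat W) x" for x
    by (induction W) simp_all
  then show ?thesis by (simp add: weight_def fun_eq_iff)
qed

lemma semistandard_map_sort:
  assumes part: "is_partition (shape W)"
    and strict: "\<forall>j < num_columns W. sorted_wrt (<) (column W j)"
  shows "semistandard (map sort W)"
proof -
  have part': "is_partition (shape (map sort W))" using part by simp
  have "map sort W ! r ! j < map sort W ! Suc r ! j"
    if r: "Suc r < length W" and j: "j < length (W ! Suc r)" for r j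
  proof -
    have "sort (W ! r) ! j < sort (W ! Suc r) ! j"
    proof (rule sort_nth_less)
      show "length (W ! Suc r) \<le> length (W ! r)"
        using partition_rows_antimono[OF part, of r "Suc r"] r by simp
      show "W ! r ! i < W ! Suc r ! i" if "i < length (W ! Suc r)" for i
        using strict columns_strict_iff[OF part] r that by blast
    qed (rule j)
    then show ?thesis using r by simp
  qed
  then have "\<forall>j < num_columns (map sort W). sorted_wrt (<) (column (map sort W) j)"
    unfolding columns_strict_iff[OF part'] by auto
  then show ?thesis using part by (simp add: semistandard_def)
qed

section \<open>A violation of the column condition destroys uniqueness\<close>

lemma length_filter_eq_sum:
  "length (filter P xs) = (\<Sum>c<length xs. of_bool (P (xs ! c)))"
proof -
  have "{c. c < length xs \<and> P (xs ! c)} = {..<length xs} \<inter> {c. P (xs ! c)}" by auto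
  then show ?thesis by (simp add: length_filter_conv_card)
qed

text \<open>
  \<open>W\<close> is \<open>T\<close> after the exchange. Were \<open>W\<close> to become \<open>T\<close> by sorting its rows, the entries up to \<open>m\<close>
  in column \<open>i\<close> of \<open>T\<close> would occupy exactly the rows in which one of the two new columns has
  an entry up to \<open>m\<close>. For each column these rows form an initial segment, so the longer of the
  two segments would have as many rows as \<open>A\<close> has entries up to \<open>m\<close>, against the choice of \<open>m\<close>.
\<close>

lemma unique_imp_column_condition:
  assumes T: "semistandard T" and unique: "unique_of_shape_and_weight T"
  shows "column_condition T"
  unfolding column_condition_def
proof (intro allI impI, rule ccontr)
  fix i j assume "i < j \<and> j < num_columns T"
  then have ij: "i < j" "j < num_columns T" by auto
  have part: "is_partition (shape T)" using T by (simp add: semistandard_def)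
  define A where "A = set (column T i)"
  define B where "B = set (column T j)"
  assume "\<not> (changes_at_most_one (column T i) (column T j) \<or> set (column T j) \<subseteq> set (column T i))"
  then have nsub: "\<not> B \<subseteq> A" and far: "card A = card B \<Longrightarrow> card (A \<inter> B) + 1 < card A"
    by (auto simp: A_def B_def changes_at_most_one_def card_set_column[OF T])
  have fin: "finite A" "finite B" by (simp_all add: A_def B_def)
  have "card B \<le> card A" using card_column_antimono[OF T] ij by (simp add: A_def B_def)
  from exists_exchange[OF fin this nsub far]
  obtain x y m where xy: "x \<in> A - B" "y \<in> B - A" and
    m: "card (insert y (A - {x}) \<inter> {..m}) > card (A \<inter> {..m}) \<or>
      card (insert y (A - {x}) \<inter> {..m}) < card (A \<inter> {..m}) \<and>
      card (insert x (B - {y}) \<inter> {..m}) < card (A \<inter> {..m})" by blast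
  define A' where "A' = insert y (A - {x})"
  define B' where "B' = insert x (B - {y})"
  have fin': "finite A'" "finite B'" using fin by (simp_all add: A'_def B'_def)
  have cardA': "card A' = card A" using xy fin unfolding A'_def
    by (metis DiffD1 DiffD2 card.remove card_insert_disjoint finite_Diff insert_Diff insert_iff)
  have cardB': "card B' = card B" using xy fin unfolding B'_def
    by (metis DiffD1 DiffD2 card.remove card_insert_disjoint finite_Diff insert_Diff insert_iff)
  define cs where "cs = (\<lambda>c. if c = i then sorted_list_of_set A'
    else if c = j then sorted_list_of_set B' else column T c)"
  have cs: "cs i = sorted_list_of_set A'" "cs j = sorted_list_of_set B'"
      "\<And>c. c \<noteq> i \<Longrightarrow> c \<noteq> j \<Longrightarrow> cs c = column T c"
    using ij by (simp_all add: cs_def)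
  have set_cs: "set (cs i) = A'" "set (cs j) = B'"
    using fin' by (simp_all add: cs)
  have len: "length (cs c) = length (column T c)" for c
    using cardA' cardB' fin'
    by (auto simp: cs_def A_def B_def card_set_column[OF T])
  have strict: "sorted_wrt (<) (cs c)" for c
    using strict_column[OF T] by (simp add: cs_def)
  define W where "W = tableau_of_columns (shape T) cs"
  have sh: "shape W = shape T" by (simp add: W_def)
  have partW: "is_partition (shape W)" using part sh by simp
  have colW: "column W c = cs c" for c
    unfolding W_def by (rule column_tableau_of_columns[OF part len])
  have "weight W = weight T"
  proof
    fix z
    let ?M = "num_columns T"
    have sub: "{i, j} \<subseteq> {..<?M}" using ij by auto
    have two: "(\<Sum>c\<in>{i, j}. of_bool (z \<in> set (cs c))) =
        (\<Sum>c\<in>{i, j}. of_bool (z \<in> set (column T c)) :: nat)"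
      using ij(1) xy set_cs
      by (auto simp: A'_def B'_def A_def[symmetric] B_def[symmetric] simp del: sum_of_bool_eq)
    have "(\<Sum>c\<in>{..<?M} - {i, j}. of_bool (z \<in> set (cs c))) =
        (\<Sum>c\<in>{..<?M} - {i, j}. of_bool (z \<in> set (column T c)) :: nat)"
      by (rule sum.cong) (auto simp: cs)
    with two have "(\<Sum>c<?M. of_bool (z \<in> set (cs c))) =
        (\<Sum>c<?M. of_bool (z \<in> set (column T c)) :: nat)"
      unfolding sum.subset_diff[OF sub finite_lessThan] by (simp only:)
    moreover have "weight W z = (\<Sum>c<?M. of_bool (z \<in> set (cs c)))"
      using weight_eq_card_columns[OF partW, of z] strict
      unfolding colW num_columns_cong[OF sh] strict_sorted_iff by blast
    moreover have "weight T z = (\<Sum>c<?M. of_bool (z \<in> set (column T c)))"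
      by (rule weight_eq_card_columns[OF part distinct_column[OF T]])
    ultimately show "weight W z = weight T z" by (simp only:)
  qed
  moreover have "semistandard (map sort W)"
    by (rule semistandard_map_sort[OF partW]) (simp add: colW strict)
  ultimately have WT: "map sort W = T"
    using unique sh by (simp add: unique_of_shape_and_weight_def)
  \<comment> \<open>Rows of \<open>W\<close> and \<open>T\<close> agree as multisets and, outside columns \<open>i\<close> and \<open>j\<close>, entry by entry.
    So each row has as many entries \<open>\<le> m\<close> in these two columns of \<open>W\<close> as in those of \<open>T\<close>, and in
    \<open>T\<close> the left one of the two is the smaller.\<close>
  have rows: "r < card (A \<inter> {..m}) \<longleftrightarrow> r < card (A' \<inter> {..m}) \<or> r < card (B' \<inter> {..m})"
    if r: "r < card A" for r
  proof -
    have ri: "r < length (column T i)" "r < length (column W i)"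
      using r len by (simp_all add: A_def card_set_column[OF T] colW)
    have rT: "r < length T" "i < length (T ! r)" using ri less_length_column_iff[OF part] by auto
    define L where "L = length (T ! r)"
    have rW: "r < length W" "length (W ! r) = L"
      using length_shape_cong[OF sh] length_row_cong[OF sh] rT by (simp_all add: L_def)
    let ?f = "\<lambda>c. of_bool (W ! r ! c \<le> m) :: nat" and ?g = "\<lambda>c. of_bool (T ! r ! c \<le> m) :: nat"
    have row: "T ! r = sort (W ! r)" using WT rW(1) by (metis nth_map)
    have total: "sum ?f {..<L} = sum ?g {..<L}"
    proof -
      have "length (filter (\<lambda>v. v \<le> m) (W ! r)) = length (filter (\<lambda>v. v \<le> m) (T ! r))"
        unfolding row by (metis filter_sort length_sort)
      then show ?thesis using rW by (simp only: length_filter_eq_sum L_def)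
    qed
    define K where "K = {i, j} \<inter> {..<L}"
    have entries: "W ! r ! c = cs c ! r" "T ! r ! c = column T c ! r"
      "r < length (column T c)" "r < length (cs c)" if "c < L" for c
    proof -
      show rc: "r < length (column T c)" using that rT less_length_column_iff[OF part] by (simp add: L_def)
      show "r < length (cs c)" using rc len by simp
      show "T ! r ! c = column T c ! r" using nth_column[OF part rc] by simp
      show "W ! r ! c = cs c ! r" using nth_column[OF partW, of r c] rc len by (simp add: colW)
    qed
    have "sum ?f ({..<L} - K) = sum ?g ({..<L} - K)"
      by (rule sum.cong) (auto simp: K_def entries cs)
    moreover have "K \<subseteq> {..<L}" by (simp add: K_def)
    ultimately have K: "sum ?f K = sum ?g K"
      using total sum.subset_diff[of K "{..<L}" ?f] sum.subset_diff[of K "{..<L}" ?g] by simp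
    have iL: "i < L" using rT by (simp add: L_def)
    have Ti: "T ! r ! i \<le> m \<longleftrightarrow> r < card (A \<inter> {..m})"
      using nth_le_iff_strict_sorted[OF strict_column[OF T] ri(1)] entries(2)[OF iL]
      by (simp add: A_def)
    have Wi: "W ! r ! i \<le> m \<longleftrightarrow> r < card (A' \<inter> {..m})"
      using nth_le_iff_strict_sorted[OF strict entries(4)[OF iL]] entries(1)[OF iL] fin'
      by (simp add: cs)
    show ?thesis
    proof (cases "j < L")
      case True
      then have "K = {i, j}" using iL by (auto simp: K_def)
      then have eq: "?f i + ?f j = ?g i + ?g j" using K ij(1) by (simp del: sum_of_bool_eq)
      have "sorted (T ! r)" unfolding row by simp
      then have "T ! r ! i \<le> T ! r ! j" using ij(1) True by (simp add: sorted_nth_mono L_def)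
      then have "T ! r ! i \<le> m \<longleftrightarrow> W ! r ! i \<le> m \<or> W ! r ! j \<le> m"
        using eq by (auto simp: of_bool_def split: if_splits)
      moreover have "W ! r ! j \<le> m \<longleftrightarrow> r < card (B' \<inter> {..m})"
        using nth_le_iff_strict_sorted[OF strict entries(4)[OF True]] entries(1)[OF True] fin'
        by (simp add: cs)
      ultimately show ?thesis using Ti Wi by simp
    next
      case False
      then have "K = {i}" using iL by (auto simp: K_def)
      then have "T ! r ! i \<le> m \<longleftrightarrow> W ! r ! i \<le> m" using K
        by (auto simp: of_bool_def simp del: sum_of_bool_eq split: if_splits)
      moreover have "\<not> r < length (column T j)"
        using False rT less_length_column_iff[OF part] by (simp add: L_def)
      then have "card B' \<le> r" using cardB' by (simp add: B_def card_set_column[OF T])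
      then have "\<not> r < card (B' \<inter> {..m})"
        using card_mono[OF fin'(2), of "B' \<inter> {..m}"] by simp
      ultimately show ?thesis using Ti Wi by simp
    qed
  qed
  from m show False
    unfolding A'_def[symmetric] B'_def[symmetric]
  proof
    assume more: "card (A \<inter> {..m}) < card (A' \<inter> {..m})"
    have "card (A' \<inter> {..m}) \<le> card A'" using fin' by (simp add: card_mono)
    then have "card (A \<inter> {..m}) < card A" using more cardA' by simp
    then show False using rows[of "card (A \<inter> {..m})"] more by simp
  next
    assume less: "card (A' \<inter> {..m}) < card (A \<inter> {..m}) \<and> card (B' \<inter> {..m}) < card (A \<inter> {..m})"
    have "card (A \<inter> {..m}) \<le> card A" using fin by (simp add: card_mono)
    then show False using rows[of "card (A \<inter> {..m}) - 1"] less by linarith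
  qed
qed

theorem proposition1p3:
  fixes T :: tableau and n :: nat
  assumes "semistandard T" and "boxes T = n"
  shows "unique_of_shape_and_weight T \<longleftrightarrow> column_condition T"
  using assms(1) column_condition_imp_unique unique_imp_column_condition by blast

end
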